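(* Let $k,n$ be positive integers, let $\mathcal{G}_k$ be the finite set of all labeled, undirected (simple) graphs with $k$ vertices, let $z:\mathcal{G}_k\to\mathbb{R}^n$ be a function, and let $t\in\mathbb{R}^n$. Let $C$ be the convex hull of $z(\mathcal{G}_k)$ in $\mathbb{R}^n$. For $\theta\in\mathbb{R}^n$ put $$L(\theta)=\frac{e^{\theta\cdot t}}{\sum_{\bar g\in\mathcal{G}_k}e^{\theta\cdot z(\bar g)}},$$ and let $\mathrm{Pr}_\theta$ be the probability distribution on $\mathcal{G}_k$ given by $$\mathrm{Pr}_\theta(g)=\frac{e^{\theta\cdot z(g)}}{\sum_{\bar g\in\mathcal{G}_k}e^{\theta\cdot z(\bar g)}}.$$ Suppose $t\notin C$. Then there exists a sequence of parameters $\{\theta_i\}_{i\in\mathbb{N}}$ in $\mathbb{R}^n$ such that (1) $\lim_{i\to\infty}L(\theta_i)=\infty$, and (2) $\lim_{i\to\infty}\mathrm{Pr}_{\theta_i}\left(\{g\in\mathcal{G}_k \mid z(g)\text{ is in the boundary of } C\}\right)=1$.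
   Context: "Labeled" means that isomorphic graphs are not identified. The boundary of $C$ is its boundary as a subset of $\mathbb{R}^n$. *)

theory Defs
  imports "HOL-Probability.Probability" "Graph_Theory.Pair_Digraph"
begin

text \<open>
  The labels are the numbers below k, and distinct labeled graphs are distinct even when isomorphic.
  A \<^locale>\<open>pair_graph\<close> is a finite, loop-free, symmetric digraph whose arcs are pairs of vertices
  (so there are no parallel arcs): the undirected edge uv is the pair of arcs (u, v), (v, u).
\<close>

definition labeled_graphs :: "nat \<Rightarrow> nat pair_pre_digraph set" where
  "labeled_graphs k = {G. pair_graph G \<and> pverts G = {..<k}}"

text \<open>
  In the following, only the values of the statistic z on \<open>labeled_graphs k\<close> matter.
\<close>

definition partition_sum ::
    "nat \<Rightarrow> (nat pair_pre_digraph \<Rightarrow> real ^ 'n) \<Rightarrow> real ^ 'n \<Rightarrow> real" where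
  "partition_sum k z \<theta> = (\<Sum>g\<in>labeled_graphs k. exp (\<theta> \<bullet> z g))"

definition ergm_likelihood ::
    "nat \<Rightarrow> (nat pair_pre_digraph \<Rightarrow> real ^ 'n) \<Rightarrow> real ^ 'n \<Rightarrow> real ^ 'n \<Rightarrow> real" where
  "ergm_likelihood k z t \<theta> = exp (\<theta> \<bullet> t) / partition_sum k z \<theta>"

definition ergm ::
    "nat \<Rightarrow> (nat pair_pre_digraph \<Rightarrow> real ^ 'n) \<Rightarrow> real ^ 'n \<Rightarrow> nat pair_pre_digraph measure" where
  "ergm k z \<theta> =
    point_measure (labeled_graphs k) (\<lambda>g. ennreal (exp (\<theta> \<bullet> z g) / partition_sum k z \<theta>))"

lemma finite_labeled_graphs: "finite (labeled_graphs k)"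
proof (rule finite_subset)
  show "labeled_graphs k \<subseteq>
      (\<lambda>A. \<lparr>pverts = {..<k}, parcs = A\<rparr>) ` Pow ({..<k} \<times> {..<k})"
  proof
    fix G assume G: "G \<in> labeled_graphs k"
    then interpret pair_graph G by (simp add: labeled_graphs_def)
    have "pverts G = {..<k}" using G by (simp add: labeled_graphs_def)
    moreover from this have "parcs G \<subseteq> {..<k} \<times> {..<k}"
      using arc_fst_in_verts arc_snd_in_verts by fastforce
    ultimately show "G \<in> (\<lambda>A. \<lparr>pverts = {..<k}, parcs = A\<rparr>) ` Pow ({..<k} \<times> {..<k})"
      by (cases G) auto
  qed
qed simp

lemma labeled_graphs_nonempty: "labeled_graphs k \<noteq> {}"
proof -
  have "pair_graph \<lparr>pverts = {..<k}, parcs = {}\<rparr>"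
    by unfold_locales (auto simp: symmetric_def arcs_ends_def sym_def)
  then show ?thesis unfolding labeled_graphs_def by force
qed

lemma partition_sum_pos: "partition_sum k z \<theta> > 0"
  unfolding partition_sum_def
  by (intro sum_pos finite_labeled_graphs labeled_graphs_nonempty) simp

lemma prob_space_ergm: "prob_space (ergm k z \<theta>)"
proof -
  have "(\<Sum>g\<in>labeled_graphs k. exp (\<theta> \<bullet> z g) / partition_sum k z \<theta>) = 1"
    using partition_sum_pos[of k z \<theta>]
    by (simp add: partition_sum_def flip: sum_divide_distrib)
  then have "(\<Sum>g\<in>labeled_graphs k. ennreal (exp (\<theta> \<bullet> z g) / partition_sum k z \<theta>)) = 1"
    using partition_sum_pos[of k z \<theta>] by (subst sum_ennreal) (auto intro: less_imp_le)
  then show ?thesis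
    unfolding ergm_def
    by (intro prob_spaceI)
      (simp add: space_point_measure emeasure_point_measure_finite finite_labeled_graphs)
qed

lemma measure_ergm_singleton:
  assumes "g \<in> labeled_graphs k"
  shows "measure (ergm k z \<theta>) {g} = exp (\<theta> \<bullet> z g) / partition_sum k z \<theta>"
  unfolding measure_def ergm_def using assms partition_sum_pos[of k z \<theta>]
  by (subst emeasure_point_measure_finite)
    (auto simp: finite_labeled_graphs intro!: enn2real_ennreal less_imp_le divide_nonneg_pos)

end

theory Submission
  imports Defs
begin

text \<open>
  Take a hyperplane strictly separating t from C, with normal u pointing towards t, and move along
  the ray \<open>\<theta> = i u\<close>. Every exponent \<open>i (u \<bullet> z g - u \<bullet> t)\<close> tends to minus infinity, so \<open>1 / L\<close>
  tends to 0. On the other hand, the mass concentrates on the graphs that maximize \<open>u \<bullet> z g\<close>;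
  these lie in a supporting hyperplane of C and hence in its frontier.
\<close>

lemma exp_mult_of_nat_tendsto_0:
  fixes a :: real
  assumes "a < 0"
  shows "(\<lambda>i. exp (real i * a)) \<longlonglongrightarrow> 0"
proof -
  have "(\<lambda>i. exp a ^ i) \<longlonglongrightarrow> 0"
    using assms by (intro LIMSEQ_power_zero) simp
  then show ?thesis by (simp add: exp_of_nat_mult)
qed

text \<open>Since \<open>u\<close> is nonzero, the interior of the closed half-space
  \<open>{y. u \<bullet> y \<le> u \<bullet> x}\<close> is the open half-space, which misses
  \<open>x\<close>; the interior of the smaller set \<open>S\<close> misses it too.\<close>

lemma supporting_hyperplane_in_frontier:
  fixes S :: "'a::euclidean_space set"
  assumes "u \<noteq> 0" and "x \<in> S" and "\<And>y. y \<in> S \<Longrightarrow> u \<bullet> y \<le> u \<bullet> x"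
  shows "x \<in> frontier S"
proof -
  have "interior S \<subseteq> interior {y. u \<bullet> y \<le> u \<bullet> x}"
    using assms(3) by (intro interior_mono) auto
  then have "x \<notin> interior S"
    using assms(1) by auto
  then show ?thesis
    using assms(2) closure_subset by (auto simp: frontier_def)
qed

lemma convex_hull_inner_le:
  assumes "\<And>y. y \<in> S \<Longrightarrow> u \<bullet> y \<le> m" and "x \<in> convex hull S"
  shows "u \<bullet> x \<le> m"
proof -
  have "convex hull S \<subseteq> {y. u \<bullet> y \<le> m}"
    using assms(1) by (intro hull_minimal convex_halfspace_le) auto
  then show ?thesis using assms(2) by auto
qed

lemma filterlim_ergm_likelihood_ray:
  assumes "\<And>g. g \<in> labeled_graphs k \<Longrightarrow> u \<bullet> z g < u \<bullet> t"
  shows "filterlim (\<lambda>i. ergm_likelihood k z t (real i *\<^sub>R u)) at_top sequentially"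
proof -
  \<comment> \<open>\<open>S i\<close> is the reciprocal of the likelihood at
    \<open>real i *\<^sub>R u\<close>: the factor \<open>exp (real i * (u \<bullet> t))\<close> is
    absorbed into every summand, which makes all exponents negative multiples of
    \<open>i\<close>.\<close>
  define S where "S i = (\<Sum>g\<in>labeled_graphs k. exp (real i * (u \<bullet> z g - u \<bullet> t)))" for i
  have lim: "S \<longlonglongrightarrow> 0"
    unfolding S_def using assms by (intro tendsto_null_sum exp_mult_of_nat_tendsto_0) simp
  have S_eq: "S i = partition_sum k z (real i *\<^sub>R u) / exp (real i * (u \<bullet> t))" for i
    by (simp add: S_def partition_sum_def exp_diff right_diff_distrib sum_divide_distrib)
  \<comment> \<open>Positivity makes the reciprocals of this null sequence diverge to plus infinity,
    not merely in absolute value.\<close>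
  have "S i > 0" for i
    unfolding S_eq by (simp add: partition_sum_pos)
  then have "filterlim (\<lambda>i. inverse (S i)) at_top sequentially"
    using lim by (intro filterlim_inverse_at_top always_eventually) auto
  then show ?thesis
    by (simp add: S_eq ergm_likelihood_def)
qed

text \<open>Keeping only the summand of \<open>h\<close> in the partition sum bounds the probability
  of \<open>g\<close> by a ratio of two exponentials, which decays geometrically in
  \<open>i\<close>.\<close>

lemma measure_ergm_ray_tendsto_0:
  assumes "g \<in> labeled_graphs k" "h \<in> labeled_graphs k" and "u \<bullet> z g < u \<bullet> z h"
  shows "(\<lambda>i. measure (ergm k z (real i *\<^sub>R u)) {g}) \<longlonglongrightarrow> 0"
proof (rule tendsto_sandwich[OF _ _ tendsto_const])
  show "(\<lambda>i. exp (real i * (u \<bullet> z g - u \<bullet> z h))) \<longlonglongrightarrow> 0"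
    using assms(3) by (intro exp_mult_of_nat_tendsto_0) simp
  have "measure (ergm k z (real i *\<^sub>R u)) {g} \<le> exp (real i * (u \<bullet> z g - u \<bullet> z h))" for i
  proof -
    have "exp ((real i *\<^sub>R u) \<bullet> z h) \<le> partition_sum k z (real i *\<^sub>R u)"
      unfolding partition_sum_def
      using assms(2) by (intro member_le_sum finite_labeled_graphs) auto
    then have "measure (ergm k z (real i *\<^sub>R u)) {g}
        \<le> exp ((real i *\<^sub>R u) \<bullet> z g) / exp ((real i *\<^sub>R u) \<bullet> z h)"
      unfolding measure_ergm_singleton[OF assms(1)]
      by (intro divide_left_mono) (auto simp: partition_sum_pos)
    then show ?thesis by (simp add: exp_diff right_diff_distrib)
  qed
  then show "\<forall>\<^sub>F i in sequentially. measure (ergm k z (real i *\<^sub>R u)) {g}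
      \<le> exp (real i * (u \<bullet> z g - u \<bullet> z h))" by simp
qed simp

text \<open>The complement of \<open>A\<close> is a finite union of singletons whose masses vanish
  in the limit. \<open>A\<close> may also contain graphs that do not maximize
  \<open>u \<bullet> z g\<close>, as the frontier event can.\<close>

lemma measure_ergm_ray_tendsto_1:
  assumes "A \<subseteq> labeled_graphs k" and "h \<in> labeled_graphs k"
    and "\<And>g. g \<in> labeled_graphs k - A \<Longrightarrow> u \<bullet> z g < u \<bullet> z h"
  shows "(\<lambda>i. measure (ergm k z (real i *\<^sub>R u)) A) \<longlonglongrightarrow> 1"
proof -
  have "measure (ergm k z \<theta>) A = 1 - (\<Sum>g\<in>labeled_graphs k - A. measure (ergm k z \<theta>) {g})" for \<theta>
  proof -
    interpret prob_space "ergm k z \<theta>" by (rule prob_space_ergm)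
    have sets: "sets (ergm k z \<theta>) = Pow (labeled_graphs k)"
      and space: "space (ergm k z \<theta>) = labeled_graphs k"
      by (simp_all add: ergm_def sets_point_measure space_point_measure)
    have "prob (labeled_graphs k - A) = (\<Sum>g\<in>labeled_graphs k - A. prob {g})"
      using sets by (intro finite_measure_eq_sum_singleton) (auto simp: finite_labeled_graphs)
    moreover have "prob (labeled_graphs k - A) = 1 - prob A"
      using prob_compl[of A] assms(1) sets space by simp
    ultimately show ?thesis by simp
  qed
  moreover have
    "(\<lambda>i. 1 - (\<Sum>g\<in>labeled_graphs k - A. measure (ergm k z (real i *\<^sub>R u)) {g})) \<longlonglongrightarrow> 1 - 0"
    using assms
    by (intro tendsto_diff tendsto_const tendsto_null_sum measure_ergm_ray_tendsto_0) auto
  ultimately show ?thesis by simp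
qed

theorem theorem2:
  fixes k :: nat
    and z :: "nat pair_pre_digraph \<Rightarrow> real ^ 'n"
    and t :: "real ^ 'n"
  assumes "k > 0"
    and "t \<notin> convex hull (z ` labeled_graphs k)"
  shows "\<exists>\<theta> :: nat \<Rightarrow> real ^ 'n.
    filterlim (\<lambda>i. ergm_likelihood k z t (\<theta> i)) at_top sequentially \<and>
    (\<lambda>i. measure (ergm k z (\<theta> i))
       {g \<in> labeled_graphs k. z g \<in> frontier (convex hull (z ` labeled_graphs k))})
      \<longlonglongrightarrow> 1"
proof -
  let ?G = "labeled_graphs k"
  let ?C = "convex hull (z ` ?G)"
  have "compact ?C"
    by (intro compact_convex_hull finite_imp_compact finite_imageI finite_labeled_graphs)
  then obtain a b where ab: "a \<bullet> t < b" "\<forall>x\<in>?C. a \<bullet> x > b"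
    using separating_hyperplane_closed_point[OF convex_convex_hull _ assms(2)]
      compact_imp_closed by blast
  \<comment> \<open>The separation theorem puts \<open>t\<close> on the lower side of the
    hyperplane, so the sign is flipped to make \<open>u\<close> point towards
    \<open>t\<close>.\<close>
  define u where "u = - a"
  have hull: "z g \<in> ?C" if "g \<in> ?G" for g
    using that by (simp add: hull_inc)
  have less: "u \<bullet> z g < u \<bullet> t" if "g \<in> ?G" for g
    using ab hull[OF that] by (auto simp: u_def)
  \<comment> \<open>There is at least one graph, and for it the strict inequality
    \<open>less\<close> would read \<open>0 < 0\<close> if \<open>u\<close> were zero.\<close>
  then have "u \<noteq> 0"
    using labeled_graphs_nonempty[of k] by fastforce
  have "Max ((\<lambda>g. u \<bullet> z g) ` ?G) \<in> (\<lambda>g. u \<bullet> z g) ` ?G"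
    by (intro Max_in) (auto simp: finite_labeled_graphs labeled_graphs_nonempty)
  then obtain h where h: "h \<in> ?G" "Max ((\<lambda>g. u \<bullet> z g) ` ?G) = u \<bullet> z h"
    by auto
  have max: "u \<bullet> z g \<le> u \<bullet> z h" if "g \<in> ?G" for g
    unfolding h(2)[symmetric] using that by (simp add: finite_labeled_graphs)
  have "z g \<in> frontier ?C" if "g \<in> ?G" "u \<bullet> z g = u \<bullet> z h" for g
  proof (rule supporting_hyperplane_in_frontier[OF \<open>u \<noteq> 0\<close> hull[OF that(1)]])
    \<comment> \<open>The bound holds at the generators \<open>z g\<close> by maximality of
      \<open>h\<close> and passes to their convex hull because a half-space is convex.\<close>
    show "u \<bullet> y \<le> u \<bullet> z g" if "y \<in> ?C" for y
      using max \<open>u \<bullet> z g = u \<bullet> z h\<close> that by (auto intro: convex_hull_inner_le[of "z ` ?G"])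
  qed
  \<comment> \<open>Contrapositive: a graph off the frontier cannot attain the maximum, so its
    inequality is strict.\<close>
  then have "u \<bullet> z g < u \<bullet> z h" if "g \<in> ?G - {g \<in> ?G. z g \<in> frontier ?C}" for g
    using max[of g] that by force
  then have "(\<lambda>i. measure (ergm k z (real i *\<^sub>R u)) {g \<in> ?G. z g \<in> frontier ?C}) \<longlonglongrightarrow> 1"
    using h(1) by (intro measure_ergm_ray_tendsto_1) auto
  with filterlim_ergm_likelihood_ray[of k u z t, OF less] show ?thesis
    by (intro exI[of _ "\<lambda>i. real i *\<^sub>R u"] conjI)
qed

end
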